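(* No mono-unstable $0$-skeleton in $\mathbb{R}^3$ exists with $V<11$ vertices. That is, no $3$-dimensional convex polytope in $\mathbb{R}^3$ with fewer than $11$ vertices is mono-unstable as a $0$-skeleton.
   Context: Let $P\subseteq\mathbb{R}^d$ be a $d$-dimensional (bounded) convex polytope with vertices $r_1,\dots,r_V$. Regarded as a $0$-skeleton, $P$ carries a unit point mass at each of its vertices (and no other mass), so its center of mass is $g=\frac1V\sum_{i=1}^V r_i$, which lies in the interior of $P$. A point $q$ of the boundary of $P$ is an equilibrium point (with respect to $g$) if the hyperplane $h$ through $q$ perpendicular to the line segment $[g,q]$ supports $P$ at $q$. An equilibrium point $q$ is nondegenerate if $h\cap P$ is the unique face of $P$ (of dimension $k\in\{0,1,\dots,d-1\}$) that contains $q$ in its relative interior. A nondegenerate equilibrium point $q$ is unstable if $\dim(h\cap P)=0$; equivalently, $q$ is a vertex of $P$ and $h\cap P=\{q\}$. Only nondegenerate equilibrium points are counted; $U$ denotes the number of unstable equilibria. A $0$-skeleton is mono-unstable if $U=1$. Here $d=3$. *)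

theory Defs
  imports "HOL-Analysis.Analysis"
begin

definition vertices :: "'a::euclidean_space set \<Rightarrow> 'a set" where
  "vertices P = {r. r extreme_point_of P}"

text \<open>Center of mass of \<open>P\<close> as a 0-skeleton, i.e. with a unit mass at each vertex and no other mass.\<close>

definition skeleton_center :: "'a::euclidean_space set \<Rightarrow> 'a" where
  "skeleton_center P = (1 / real (card (vertices P))) *\<^sub>R (\<Sum>r\<in>vertices P. r)"

definition perp_hyperplane :: "'a::euclidean_space \<Rightarrow> 'a \<Rightarrow> 'a set" where
  "perp_hyperplane g q = {x. (q - g) \<bullet> (x - q) = 0}"

text \<open>The normal \<open>a\<close> may be replaced by its negative, so either closed half-space bounded by \<open>h\<close>
  may contain \<open>P\<close>; \<open>a \<noteq> 0\<close> makes \<open>h\<close> a genuine hyperplane.\<close>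

definition supports_at :: "'a::euclidean_space set \<Rightarrow> 'a set \<Rightarrow> 'a \<Rightarrow> bool" where
  "supports_at h P q \<longleftrightarrow> q \<in> h \<inter> P \<and>
     (\<exists>a b. a \<noteq> 0 \<and> h = {x. a \<bullet> x = b} \<and> P \<subseteq> {x. a \<bullet> x \<le> b})"

definition equilibrium_point :: "'a::euclidean_space set \<Rightarrow> 'a \<Rightarrow> 'a \<Rightarrow> bool" where
  "equilibrium_point P g q \<longleftrightarrow> q \<in> frontier P \<and> supports_at (perp_hyperplane g q) P q"

text \<open>The singleton equation says that \<open>h \<inter> P\<close> is the unique face of dimension \<open>0, \<dots>, d - 1\<close>
  with \<open>q\<close> in its relative interior; the dimension bounds exclude the improper faces
  \<open>{}\<close> and \<open>P\<close>, which the library counts as faces.\<close>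

definition nondegenerate_equilibrium :: "'a::euclidean_space set \<Rightarrow> 'a \<Rightarrow> 'a \<Rightarrow> bool" where
  "nondegenerate_equilibrium P g q \<longleftrightarrow> equilibrium_point P g q \<and>
     {F. F face_of P \<and> 0 \<le> aff_dim F \<and> aff_dim F \<le> int DIM('a) - 1 \<and> q \<in> rel_interior F}
       = {perp_hyperplane g q \<inter> P}"

definition unstable_equilibrium :: "'a::euclidean_space set \<Rightarrow> 'a \<Rightarrow> 'a \<Rightarrow> bool" where
  "unstable_equilibrium P g q \<longleftrightarrow> nondegenerate_equilibrium P g q \<and>
     aff_dim (perp_hyperplane g q \<inter> P) = 0"

definition mono_unstable_skeleton :: "'a::euclidean_space set \<Rightarrow> bool" where
  "mono_unstable_skeleton P \<longleftrightarrow> card {q. unstable_equilibrium P (skeleton_center P) q} = 1"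

end

theory Submission
  imports Defs
begin

text \<open>Put the center of mass at the origin. A vertex \<open>y\<close> is an unstable equilibrium as soon as
  \<open>x \<bullet> y < y \<bullet> y\<close> for every other vertex \<open>x\<close> (lemma \<open>extreme_point_unstable\<close>). If there is
  only one unstable equilibrium, then every vertex \<open>y\<close> except the longest one, \<open>v\<close>, has a
  \<^emph>\<open>parent\<close>: another vertex \<open>x\<close> with \<open>y \<bullet> y \<le> x \<bullet> y\<close>, which says that \<open>y\<close> lies in the ball with
  diameter \<open>[0, x]\<close>. A parent is strictly longer than its child, so the vertices form a tree with
  root \<open>v\<close>. They also sum to zero, so the vertices other than \<open>v\<close>, at most nine of them, sum to
  \<open>- v\<close>. The theorem therefore follows from an estimate on trees in an arbitrary inner product space
  (lemma \<open>hangs_9\<close>): if at most nine vectors hang in this way below \<open>p\<close> and \<open>T\<close> is their sum,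
  then \<open>\<parallel>p + T\<parallel>\<^sup>2 \<ge> \<parallel>p\<parallel>\<^sup>2 / 10000\<close>.

  Everything known about the tree is an inequality between inner products, so the possible values of
  \<open>(p \<bullet> T, T \<bullet> T)\<close> for \<open>p \<bullet> p = 1\<close> are estimated by half-planes, that is, by inequalities
  \<open>A (T \<bullet> T) + 100 (p \<bullet> T) + C (p \<bullet> p) \<ge> 0\<close> (\<open>quad_bound\<close>). For each number \<open>m\<close> of hanging vectors one or
  two such inequalities suffice, and they are obtained by recursion on \<open>m\<close>. Let \<open>r\<close> be the child of
  \<open>p\<close> with the smallest branch, let \<open>U\<close> be the sum of what hangs below \<open>r\<close>, and let \<open>S\<close> be the sum of the other
  branches, so \<open>T = S + r + U\<close>. The inequalities known for \<open>(p, S)\<close> and \<open>(r, U)\<close>, together with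
  \<open>r \<bullet> r \<le> p \<bullet> r\<close>, imply the one for \<open>(p, T)\<close> if, after subtracting suitable nonnegative multiples
  of them, a positive definite quadratic form in the four vectors \<open>S, U, r, p\<close> remains
  (lemma \<open>quad_bound_split\<close>). Such a certificate consists of three numbers, and its verification is
  rational arithmetic. Taking the smallest branch keeps the number of cases small
  (lemma \<open>hangs_smallest_branch\<close>).

  The constants come from a numerical optimization: given \<open>A\<close>, the value \<open>C\<close> is the least one that the
  recursion yields from the bounds for fewer vectors, rounded up, and the values of \<open>A\<close> were
  chosen to make the last step, to nine vectors, succeed. The margin there is small; for two chains of five and four vectors below \<open>p\<close>, the
  sum \<open>p + T\<close> can be as short as about \<open>0.063 \<parallel>p\<parallel>\<close>.\<close>

section \<open>Positive definite forms in inner product spaces\<close>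

text \<open>The arguments are the rows of the upper triangle of a symmetric matrix. Positivity is tested by
  symmetric elimination: after the pivot \<open>a\<close> comes the Schur complement, multiplied by \<open>a\<close> to
  avoid division.\<close>

definition pos_def2 :: "real \<Rightarrow> real \<Rightarrow> real \<Rightarrow> bool" where
  "pos_def2 a b d \<longleftrightarrow> 0 < a \<and> b * b < a * d"

definition pos_def3 :: "real \<Rightarrow> real \<Rightarrow> real \<Rightarrow> real \<Rightarrow> real \<Rightarrow> real \<Rightarrow> bool" where
  "pos_def3 a b c e f h \<longleftrightarrow> 0 < a \<and> pos_def2 (a * e - b * b) (a * f - b * c) (a * h - c * c)"

definition pos_def4 ::
  "real \<Rightarrow> real \<Rightarrow> real \<Rightarrow> real \<Rightarrow> real \<Rightarrow> real \<Rightarrow> real \<Rightarrow> real \<Rightarrow> real \<Rightarrow> real \<Rightarrow> bool" where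
  "pos_def4 a b c d e f g h i j \<longleftrightarrow> 0 < a \<and>
     pos_def3 (a * e - b * b) (a * f - b * c) (a * g - b * d) (a * h - c * c) (a * i - c * d) (a * j - d * d)"

lemmas pos_def_defs = pos_def2_def pos_def3_def pos_def4_def

text \<open>Completing the square also works when the variables are vectors, because the identity involves
  only their inner products. This is why the dimension of the space never matters.\<close>
lemma pos_def2_form_nonneg:
  fixes x y :: "'a::real_inner"
  assumes "pos_def2 a b d"
  shows "0 \<le> a * (x \<bullet> x) + 2 * b * (x \<bullet> y) + d * (y \<bullet> y)" (is "0 \<le> ?Q")
proof -
  have "a * ?Q = (a *\<^sub>R x + b *\<^sub>R y) \<bullet> (a *\<^sub>R x + b *\<^sub>R y) + (a * d - b * b) * (y \<bullet> y)"
    by (simp add: inner_simps inner_commute[of y x] algebra_simps)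
  also have "\<dots> \<ge> 0"
    using assms by (auto simp: pos_def2_def intro!: add_nonneg_nonneg mult_nonneg_nonneg)
  finally show ?thesis
    using assms by (simp add: pos_def2_def zero_le_mult_iff)
qed

lemma pos_def3_form_nonneg:
  fixes x y z :: "'a::real_inner"
  assumes "pos_def3 a b c e f h"
  shows "0 \<le> a * (x \<bullet> x) + 2 * b * (x \<bullet> y) + 2 * c * (x \<bullet> z)
           + e * (y \<bullet> y) + 2 * f * (y \<bullet> z) + h * (z \<bullet> z)" (is "0 \<le> ?Q")
proof -
  have "a * ?Q = (a *\<^sub>R x + b *\<^sub>R y + c *\<^sub>R z) \<bullet> (a *\<^sub>R x + b *\<^sub>R y + c *\<^sub>R z)
      + ((a * e - b * b) * (y \<bullet> y) + 2 * (a * f - b * c) * (y \<bullet> z) + (a * h - c * c) * (z \<bullet> z))"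
    by (simp add: inner_simps inner_commute[of y x] inner_commute[of z x] inner_commute[of z y]
        algebra_simps)
  also have "\<dots> \<ge> 0"
    using assms by (intro add_nonneg_nonneg inner_ge_zero pos_def2_form_nonneg)
      (auto simp: pos_def3_def)
  finally show ?thesis
    using assms by (simp add: pos_def3_def zero_le_mult_iff)
qed

lemma pos_def4_form_nonneg:
  fixes x y z w :: "'a::real_inner"
  assumes "pos_def4 a b c d e f g h i j"
  shows "0 \<le> a * (x \<bullet> x) + 2 * b * (x \<bullet> y) + 2 * c * (x \<bullet> z) + 2 * d * (x \<bullet> w)
           + e * (y \<bullet> y) + 2 * f * (y \<bullet> z) + 2 * g * (y \<bullet> w)
           + h * (z \<bullet> z) + 2 * i * (z \<bullet> w) + j * (w \<bullet> w)" (is "0 \<le> ?Q")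
proof -
  have "a * ?Q = (a *\<^sub>R x + b *\<^sub>R y + c *\<^sub>R z + d *\<^sub>R w) \<bullet> (a *\<^sub>R x + b *\<^sub>R y + c *\<^sub>R z + d *\<^sub>R w)
      + ((a * e - b * b) * (y \<bullet> y) + 2 * (a * f - b * c) * (y \<bullet> z) + 2 * (a * g - b * d) * (y \<bullet> w)
        + (a * h - c * c) * (z \<bullet> z) + 2 * (a * i - c * d) * (z \<bullet> w) + (a * j - d * d) * (w \<bullet> w))"
    by (simp add: inner_simps inner_commute[of y x] inner_commute[of z x] inner_commute[of w x]
        inner_commute[of z y] inner_commute[of w y] inner_commute[of w z] algebra_simps)
  also have "\<dots> \<ge> 0"
    using assms by (intro add_nonneg_nonneg[OF inner_ge_zero] pos_def3_form_nonneg)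
      (auto simp: pos_def4_def)
  finally show ?thesis
    using assms by (simp add: pos_def4_def zero_le_mult_iff)
qed

section \<open>Sums of vectors that hang below a vector\<close>

text \<open>\<open>hangs m p T\<close>: some forest of \<open>m\<close> vectors whose roots have parent \<open>p\<close> has sum \<open>T\<close>. Only the sum
  is recorded because the estimates use nothing else about the forest.\<close>
inductive hangs :: "nat \<Rightarrow> 'a::real_inner \<Rightarrow> 'a \<Rightarrow> bool" where
  hangs_none: "hangs 0 p 0"
| hangs_attach: "hangs a p T \<Longrightarrow> hangs b r U \<Longrightarrow> r \<bullet> r \<le> p \<bullet> r \<Longrightarrow> hangs (Suc (a + b)) p (T + r + U)"

lemma hangs_0D: "hangs 0 p T \<Longrightarrow> T = 0"
  by (erule hangs.cases) auto

text \<open>The zero vector may be attached anywhere, so \<open>m\<close> is in effect an upper bound on the number of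
  vectors.\<close>
lemma hangs_Suc: "hangs n p T \<Longrightarrow> hangs (Suc n) p T"
  using hangs_attach[OF _ hangs_none[of 0], of n p T] by simp

lemma hangs_mono: "hangs m p T \<Longrightarrow> m \<le> n \<Longrightarrow> hangs n p T"
  by (induction n) (auto simp: le_Suc_eq intro: hangs_Suc)

lemma hangs_Suc_cases:
  assumes "hangs (Suc n) p T"
  obtains a b S r U where "a + b = n" "hangs a p S" "hangs b r U" "r \<bullet> r \<le> p \<bullet> r" "T = S + r + U"
  using assms by (cases rule: hangs.cases) auto

text \<open>Among all ways to detach a branch, take one with the fewest vectors. If something remains, it contains
  another branch, which is not smaller; detaching that one instead leaves the first branch in place.\<close>
lemma hangs_smallest_branch:
  assumes "hangs (Suc n) p T"
  obtains (single) r U where "hangs n r U" "r \<bullet> r \<le> p \<bullet> r" "T = r + U"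
  | (split) a b S r U where "a + b = n" "b < a" "hangs a p S" "hangs b r U" "r \<bullet> r \<le> p \<bullet> r"
      "T = S + r + U"
proof -
  define splits where "splits b \<longleftrightarrow> (\<exists>a S r U. a + b = n \<and> hangs a p S \<and> hangs b r U
    \<and> r \<bullet> r \<le> p \<bullet> r \<and> T = S + r + U)" for b
  define b where "b = (LEAST b. splits b)"
  have ex: "\<exists>b. splits b"
    using hangs_Suc_cases[OF assms] unfolding splits_def by metis
  then have "splits b"
    unfolding b_def by (metis LeastI)
  then obtain a S r U where *: "a + b = n" "hangs a p S" "hangs b r U" "r \<bullet> r \<le> p \<bullet> r" "T = S + r + U"
    unfolding splits_def by blast
  show thesis
  proof (cases a)
    case 0
    then show thesis
      using * hangs_0D[of p S] by (intro single[of r U]) auto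
  next
    case (Suc a')
    obtain c d S' r' U' where S: "c + d = a'" "hangs c p S'" "hangs d r' U'" "r' \<bullet> r' \<le> p \<bullet> r'"
        "S = S' + r' + U'"
      using hangs_Suc_cases *(2) Suc by metis
    have "hangs (Suc (c + b)) p (S' + r + U)"
      using S *  by (intro hangs_attach) auto
    then have "splits d"
      unfolding splits_def using S * Suc
      by (intro exI[of _ "Suc (c + b)"] exI[of _ "S' + r + U"] exI[of _ r'] exI[of _ U']) auto
    then have "b \<le> d"
      unfolding b_def by (rule Least_le)
    then show thesis
      using * S Suc by (intro split[of a b S r U]) auto
  qed
qed

section \<open>Recursion for quadratic bounds\<close>

text \<open>For negative \<open>A\<close> this confines \<open>T\<close> to a ball centered at a positive multiple of \<open>p\<close>; for positive
  \<open>A\<close> it excludes \<open>T\<close> from a ball centered at a negative multiple of \<open>p\<close>. The factor 100 turns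
  bounds with two decimals into bounds with integer coefficients.\<close>
definition quad_bound :: "real \<Rightarrow> real \<Rightarrow> 'a::real_inner \<Rightarrow> 'a \<Rightarrow> bool" where
  "quad_bound A C p T \<longleftrightarrow> 0 \<le> A * (T \<bullet> T) + 100 * (p \<bullet> T) + C * (p \<bullet> p)"

text \<open>Subtract \<open>m1\<close> times the bound on \<open>S\<close>, \<open>m2\<close> times the bound on \<open>U\<close> and \<open>l\<close> times
  \<open>p \<bullet> r - r \<bullet> r \<ge> 0\<close> from the claim. What remains is the quadratic form of the stated matrix in
  \<open>S, U, r, p\<close>.\<close>
lemma quad_bound_split:
  fixes p r S U :: "'a::real_inner"
  assumes r: "r \<bullet> r \<le> p \<bullet> r" and S: "quad_bound A1 C1 p S" and U: "quad_bound A2 C2 r U"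
    and nn: "0 \<le> l" "0 \<le> m1" "0 \<le> m2"
    and pd: "pos_def4 (A - m1 * A1) A A (50 - 50 * m1) (A - m2 * A2) (A - 50 * m2) 50
               (A + l - m2 * C2) (50 - l / 2) (C - m1 * C1)"
  shows "quad_bound A C p (S + r + U)"
proof -
  have "0 \<le> m1 * (A1 * (S \<bullet> S) + 100 * (p \<bullet> S) + C1 * (p \<bullet> p))"
    using S nn by (simp add: quad_bound_def)
  moreover have "0 \<le> m2 * (A2 * (U \<bullet> U) + 100 * (r \<bullet> U) + C2 * (r \<bullet> r))"
    using U nn by (simp add: quad_bound_def)
  moreover have "0 \<le> l * (p \<bullet> r - r \<bullet> r)"
    using r nn by simp
  moreover note pos_def4_form_nonneg[OF pd, of S U r p]
  ultimately show ?thesis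
    unfolding quad_bound_def
    by (simp add: inner_simps inner_commute[of U S] inner_commute[of r S] inner_commute[of r U]
        inner_commute[of S p] inner_commute[of U p] inner_commute[of r p] algebra_simps)
qed

text \<open>The same certificate when nothing hangs below \<open>r\<close>.\<close>
lemma quad_bound_leaf:
  fixes p r S :: "'a::real_inner"
  assumes r: "r \<bullet> r \<le> p \<bullet> r" and S: "quad_bound A1 C1 p S"
    and nn: "0 \<le> l" "0 \<le> m"
    and pd: "pos_def3 (A - m * A1) A (50 - 50 * m) (A + l) (50 - l / 2) (C - m * C1)"
  shows "quad_bound A C p (S + r)"
proof -
  have "0 \<le> m * (A1 * (S \<bullet> S) + 100 * (p \<bullet> S) + C1 * (p \<bullet> p))"
    using S nn by (simp add: quad_bound_def)
  moreover have "0 \<le> l * (p \<bullet> r - r \<bullet> r)"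
    using r nn by simp
  moreover note pos_def3_form_nonneg[OF pd, of S r p]
  ultimately show ?thesis
    unfolding quad_bound_def
    by (simp add: inner_simps inner_commute[of r S] inner_commute[of S p] inner_commute[of r p]
        algebra_simps)
qed

text \<open>The same certificate when \<open>r\<close> is the only child of \<open>p\<close>.\<close>
lemma quad_bound_single:
  fixes p r U :: "'a::real_inner"
  assumes r: "r \<bullet> r \<le> p \<bullet> r" and U: "quad_bound A2 C2 r U"
    and nn: "0 \<le> l" "0 \<le> m"
    and pd: "pos_def3 (A - m * A2) (A - 50 * m) 50 (A + l - m * C2) (50 - l / 2) C"
  shows "quad_bound A C p (r + U)"
proof -
  have "0 \<le> m * (A2 * (U \<bullet> U) + 100 * (r \<bullet> U) + C2 * (r \<bullet> r))"
    using U nn by (simp add: quad_bound_def)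
  moreover have "0 \<le> l * (p \<bullet> r - r \<bullet> r)"
    using r nn by simp
  moreover note pos_def3_form_nonneg[OF pd, of U r p]
  ultimately show ?thesis
    unfolding quad_bound_def
    by (simp add: inner_simps inner_commute[of r U] inner_commute[of U p]
        inner_commute[of r p] algebra_simps)
qed

text \<open>A smallest branch that is not the only one has at most half of the at most nine vectors, so at
  most three vectors hang below \<open>r\<close>.\<close>
lemma quad_bound_cases:
  assumes "hangs m p T" "m = n + 1" "n \<le> 8"
    and "\<And>r U. r \<bullet> r \<le> p \<bullet> r \<Longrightarrow> hangs n r U \<Longrightarrow> quad_bound A C p (r + U)"
    and "\<And>S r. r \<bullet> r \<le> p \<bullet> r \<Longrightarrow> hangs n p S \<Longrightarrow> quad_bound A C p (S + r)"
    and "\<And>S r U. 3 \<le> n \<Longrightarrow> r \<bullet> r \<le> p \<bullet> r \<Longrightarrow> hangs (n - 1) p S \<Longrightarrow> hangs 1 r U \<Longrightarrow> quad_bound A C p (S + r + U)"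
    and "\<And>S r U. 5 \<le> n \<Longrightarrow> r \<bullet> r \<le> p \<bullet> r \<Longrightarrow> hangs (n - 2) p S \<Longrightarrow> hangs 2 r U \<Longrightarrow> quad_bound A C p (S + r + U)"
    and "\<And>S r U. 7 \<le> n \<Longrightarrow> r \<bullet> r \<le> p \<bullet> r \<Longrightarrow> hangs (n - 3) p S \<Longrightarrow> hangs 3 r U \<Longrightarrow> quad_bound A C p (S + r + U)"
  shows "quad_bound A C p T"
  using assms(1)[unfolded assms(2) Suc_eq_plus1[symmetric]]
proof (cases rule: hangs_smallest_branch)
  case (single r U)
  then show ?thesis using assms(4) by simp
next
  case (split a b S r U)
  have "b = 0 \<or> b = 1 \<or> b = 2 \<or> b = 3"
    using split assms(3) by auto
  moreover have "a = n - b"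
    using split by auto
  ultimately show ?thesis
    using split assms(5)[of r S] assms(6)[of r S U] assms(7)[of r S U] assms(8)[of r S U] hangs_0D[of r U]
    by auto
qed

section \<open>Bounds for up to nine hanging vectors\<close>

text \<open>Each proof lists one certificate per shape of the forest; \<open>l\<close>, \<open>m\<close>, \<open>m1\<close>, \<open>m2\<close> are
  numerical solutions of the semidefinite conditions, rounded to short decimals. For four
  to eight vectors there are two bounds. In the last step, \<open>hangs_9\<close>, the bound named \<open>below\<close> serves for
  what hangs below \<open>r\<close>, and the bound named \<open>beside\<close> for the branches that accompany \<open>r\<close>.\<close>
lemma hangs_1:
  assumes "hangs 1 p T"
  shows "quad_bound (-100) 0 p T"
proof (rule quad_bound_cases[OF assms, where n = 0])
  show "quad_bound (-100) 0 p (r + U)" if "r \<bullet> r \<le> p \<bullet> r" "hangs 0 r U" for r U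
    using that hangs_0D[of r U] by (simp add: quad_bound_def)
  show "quad_bound (-100) 0 p (S + r)" if "r \<bullet> r \<le> p \<bullet> r" "hangs 0 p S" for r S
    using that hangs_0D[of p S] by (simp add: quad_bound_def)
qed simp_all

lemma hangs_2:
  assumes "hangs 2 p T"
  shows "quad_bound (-57) 29 p T"
proof (rule quad_bound_cases[OF assms, where n = 1])
  show "quad_bound (-57) 29 p (r + U)" if "r \<bullet> r \<le> p \<bullet> r" "hangs 1 r U" for r U
    by (rule quad_bound_single[OF that(1) hangs_1[OF that(2)], where l = "248" and m = "73 / 50"])
      (simp_all add: pos_def_defs)
  show "quad_bound (-57) 29 p (S + r)" if "r \<bullet> r \<le> p \<bullet> r" "hangs 1 p S" for r S
    by (rule quad_bound_leaf[OF that(1) hangs_1[OF that(2)], where l = "130" and m = "13 / 10"])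
      (simp_all add: pos_def_defs)
qed simp_all

lemma hangs_3:
  assumes "hangs 3 p T"
  shows "quad_bound (-40) 69 p T"
proof (rule quad_bound_cases[OF assms, where n = 2])
  show "quad_bound (-40) 69 p (r + U)" if "r \<bullet> r \<le> p \<bullet> r" "hangs 2 r U" for r U
    by (rule quad_bound_single[OF that(1) hangs_2[OF that(2)], where l = "394" and m = "67 / 50"])
      (simp_all add: pos_def_defs)
  show "quad_bound (-40) 69 p (S + r)" if "r \<bullet> r \<le> p \<bullet> r" "hangs 2 p S" for r S
    by (rule quad_bound_leaf[OF that(1) hangs_2[OF that(2)], where l = "140" and m = "11 / 10"])
      (simp_all add: pos_def_defs)
qed simp_all

lemma hangs_4_below:
  assumes "hangs 4 p T"
  shows "quad_bound (-31) 121 p T"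
proof (rule quad_bound_cases[OF assms, where n = 3])
  show "quad_bound (-31) 121 p (r + U)" if "r \<bullet> r \<le> p \<bullet> r" "hangs 3 r U" for r U
    by (rule quad_bound_single[OF that(1) hangs_3[OF that(2)], where l = "5621 / 10" and m = "1293 / 1000"])
      (simp_all add: pos_def_defs)
  show "quad_bound (-31) 121 p (S + r)" if "r \<bullet> r \<le> p \<bullet> r" "hangs 3 p S" for r S
    by (rule quad_bound_leaf[OF that(1) hangs_3[OF that(2)], where l = "160" and m = "1"])
      (simp_all add: pos_def_defs)
  show "quad_bound (-31) 121 p (S + r + U)" if "r \<bullet> r \<le> p \<bullet> r" "hangs (3 - 1) p S" "hangs 1 r U" for r S U
    by (rule quad_bound_split[OF that(1) hangs_2[OF that(2)[simplified]] hangs_1[OF that(3)],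
          where l = "300" and ?m1.0 = "11 / 10" and ?m2.0 = "8 / 5"])
      (simp_all add: pos_def_defs)
qed simp_all

lemma hangs_4_beside:
  assumes "hangs 4 p T"
  shows "quad_bound (-5) 58 p T"
proof (rule quad_bound_cases[OF assms, where n = 3])
  show "quad_bound (-5) 58 p (r + U)" if "r \<bullet> r \<le> p \<bullet> r" "hangs 3 r U" for r U
    by (rule quad_bound_single[OF that(1) hangs_3[OF that(2)], where l = "250" and m = "3 / 2"])
      (simp_all add: pos_def_defs)
  show "quad_bound (-5) 58 p (S + r)" if "r \<bullet> r \<le> p \<bullet> r" "hangs 3 p S" for r S
    by (rule quad_bound_leaf[OF that(1) hangs_3[OF that(2)], where l = "107" and m = "73 / 100"])
      (simp_all add: pos_def_defs)
  show "quad_bound (-5) 58 p (S + r + U)" if "r \<bullet> r \<le> p \<bullet> r" "hangs (3 - 1) p S" "hangs 1 r U" for r S U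
    by (rule quad_bound_split[OF that(1) hangs_2[OF that(2)[simplified]] hangs_1[OF that(3)],
          where l = "160" and ?m1.0 = "4 / 5" and ?m2.0 = "23 / 5"])
      (simp_all add: pos_def_defs)
qed simp_all

lemma hangs_5_below:
  assumes "hangs 5 p T"
  shows "quad_bound (-24) 168 p T"
proof (rule quad_bound_cases[OF assms, where n = 4])
  show "quad_bound (-24) 168 p (r + U)" if "r \<bullet> r \<le> p \<bullet> r" "hangs 4 r U" for r U
    by (rule quad_bound_single[OF that(1) hangs_4_below[OF that(2)], where l = "681" and m = "63 / 50"])
      (simp_all add: pos_def_defs)
  show "quad_bound (-24) 168 p (S + r)" if "r \<bullet> r \<le> p \<bullet> r" "hangs 4 p S" for r S
    by (rule quad_bound_leaf[OF that(1) hangs_4_below[OF that(2)], where l = "150" and m = "1"])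
      (simp_all add: pos_def_defs)
  show "quad_bound (-24) 168 p (S + r + U)" if "r \<bullet> r \<le> p \<bullet> r" "hangs (4 - 1) p S" "hangs 1 r U" for r S U
    by (rule quad_bound_split[OF that(1) hangs_3[OF that(2)[simplified]] hangs_1[OF that(3)],
          where l = "280" and ?m1.0 = "1" and ?m2.0 = "8 / 5"])
      (simp_all add: pos_def_defs)
qed simp_all

lemma hangs_5_beside:
  assumes "hangs 5 p T"
  shows "quad_bound 1 61 p T"
proof (rule quad_bound_cases[OF assms, where n = 4])
  show "quad_bound 1 61 p (r + U)" if "r \<bullet> r \<le> p \<bullet> r" "hangs 4 r U" for r U
    by (rule quad_bound_single[OF that(1) hangs_4_below[OF that(2)], where l = "255" and m = "129 / 100"])
      (simp_all add: pos_def_defs)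
  show "quad_bound 1 61 p (S + r)" if "r \<bullet> r \<le> p \<bullet> r" "hangs 4 p S" for r S
    by (rule quad_bound_leaf[OF that(1) hangs_4_beside[OF that(2)], where l = "110" and m = "9 / 10"])
      (simp_all add: pos_def_defs)
  show "quad_bound 1 61 p (S + r + U)" if "r \<bullet> r \<le> p \<bullet> r" "hangs (4 - 1) p S" "hangs 1 r U" for r S U
    by (rule quad_bound_split[OF that(1) hangs_3[OF that(2)[simplified]] hangs_1[OF that(3)],
          where l = "150" and ?m1.0 = "7 / 10" and ?m2.0 = "5"])
      (simp_all add: pos_def_defs)
qed simp_all

lemma hangs_6_below:
  assumes "hangs 6 p T"
  shows "quad_bound (-18) 207 p T"
proof (rule quad_bound_cases[OF assms, where n = 5])
  show "quad_bound (-18) 207 p (r + U)" if "r \<bullet> r \<le> p \<bullet> r" "hangs 5 r U" for r U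
    by (rule quad_bound_single[OF that(1) hangs_5_below[OF that(2)], where l = "7673 / 10" and m = "627 / 500"])
      (simp_all add: pos_def_defs)
  show "quad_bound (-18) 207 p (S + r)" if "r \<bullet> r \<le> p \<bullet> r" "hangs 5 p S" for r S
    by (rule quad_bound_leaf[OF that(1) hangs_5_below[OF that(2)], where l = "150" and m = "9 / 10"])
      (simp_all add: pos_def_defs)
  show "quad_bound (-18) 207 p (S + r + U)" if "r \<bullet> r \<le> p \<bullet> r" "hangs (5 - 1) p S" "hangs 1 r U" for r S U
    by (rule quad_bound_split[OF that(1) hangs_4_below[OF that(2)[simplified]] hangs_1[OF that(3)],
          where l = "240" and ?m1.0 = "9 / 10" and ?m2.0 = "3"])
      (simp_all add: pos_def_defs)
  show "quad_bound (-18) 207 p (S + r + U)" if "r \<bullet> r \<le> p \<bullet> r" "hangs (5 - 2) p S" "hangs 2 r U" for r S U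
    by (rule quad_bound_split[OF that(1) hangs_3[OF that(2)[simplified]] hangs_2[OF that(3)],
          where l = "320" and ?m1.0 = "1" and ?m2.0 = "8 / 5"])
      (simp_all add: pos_def_defs)
qed simp_all

lemma hangs_6_beside:
  assumes "hangs 6 p T"
  shows "quad_bound 13 66 p T"
proof (rule quad_bound_cases[OF assms, where n = 5])
  show "quad_bound 13 66 p (r + U)" if "r \<bullet> r \<le> p \<bullet> r" "hangs 5 r U" for r U
    by (rule quad_bound_single[OF that(1) hangs_5_below[OF that(2)], where l = "203" and m = "26 / 25"])
      (simp_all add: pos_def_defs)
  show "quad_bound 13 66 p (S + r)" if "r \<bullet> r \<le> p \<bullet> r" "hangs 5 p S" for r S
    by (rule quad_bound_leaf[OF that(1) hangs_5_beside[OF that(2)], where l = "90" and m = "4 / 5"])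
      (simp_all add: pos_def_defs)
  show "quad_bound 13 66 p (S + r + U)" if "r \<bullet> r \<le> p \<bullet> r" "hangs (5 - 1) p S" "hangs 1 r U" for r S U
    by (rule quad_bound_split[OF that(1) hangs_4_beside[OF that(2)[simplified]] hangs_1[OF that(3)],
          where l = "130" and ?m1.0 = "4 / 5" and ?m2.0 = "22 / 5"])
      (simp_all add: pos_def_defs)
  show "quad_bound 13 66 p (S + r + U)" if "r \<bullet> r \<le> p \<bullet> r" "hangs (5 - 2) p S" "hangs 2 r U" for r S U
    by (rule quad_bound_split[OF that(1) hangs_3[OF that(2)[simplified]] hangs_2[OF that(3)],
          where l = "150" and ?m1.0 = "3 / 5" and ?m2.0 = "23 / 10"])
      (simp_all add: pos_def_defs)
qed simp_all

lemma hangs_7_below: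
  assumes "hangs 7 p T"
  shows "quad_bound (-11) 218 p T"
proof (rule quad_bound_cases[OF assms, where n = 6])
  show "quad_bound (-11) 218 p (r + U)" if "r \<bullet> r \<le> p \<bullet> r" "hangs 6 r U" for r U
    by (rule quad_bound_single[OF that(1) hangs_6_below[OF that(2)], where l = "741" and m = "5 / 4"])
      (simp_all add: pos_def_defs)
  show "quad_bound (-11) 218 p (S + r)" if "r \<bullet> r \<le> p \<bullet> r" "hangs 6 p S" for r S
    by (rule quad_bound_leaf[OF that(1) hangs_6_below[OF that(2)], where l = "140" and m = "4 / 5"])
      (simp_all add: pos_def_defs)
  show "quad_bound (-11) 218 p (S + r + U)" if "r \<bullet> r \<le> p \<bullet> r" "hangs (6 - 1) p S" "hangs 1 r U" for r S U
    by (rule quad_bound_split[OF that(1) hangs_5_below[OF that(2)[simplified]] hangs_1[OF that(3)],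
          where l = "200" and ?m1.0 = "4 / 5" and ?m2.0 = "47 / 10"])
      (simp_all add: pos_def_defs)
  show "quad_bound (-11) 218 p (S + r + U)" if "r \<bullet> r \<le> p \<bullet> r" "hangs (6 - 2) p S" "hangs 2 r U" for r S U
    by (rule quad_bound_split[OF that(1) hangs_4_below[OF that(2)[simplified]] hangs_2[OF that(3)],
          where l = "260" and ?m1.0 = "7 / 10" and ?m2.0 = "21 / 10"])
      (simp_all add: pos_def_defs)
qed simp_all

lemma hangs_7_beside:
  assumes "hangs 7 p T"
  shows "quad_bound 22 70 p T"
proof (rule quad_bound_cases[OF assms, where n = 6])
  show "quad_bound 22 70 p (r + U)" if "r \<bullet> r \<le> p \<bullet> r" "hangs 6 r U" for r U
    by (rule quad_bound_single[OF that(1) hangs_6_below[OF that(2)], where l = "147" and m = "77 / 100"])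
      (simp_all add: pos_def_defs)
  show "quad_bound 22 70 p (S + r)" if "r \<bullet> r \<le> p \<bullet> r" "hangs 6 p S" for r S
    by (rule quad_bound_leaf[OF that(1) hangs_6_beside[OF that(2)], where l = "80" and m = "4 / 5"])
      (simp_all add: pos_def_defs)
  show "quad_bound 22 70 p (S + r + U)" if "r \<bullet> r \<le> p \<bullet> r" "hangs (6 - 1) p S" "hangs 1 r U" for r S U
    by (rule quad_bound_split[OF that(1) hangs_5_beside[OF that(2)[simplified]] hangs_1[OF that(3)],
          where l = "120" and ?m1.0 = "7 / 10" and ?m2.0 = "18 / 5"])
      (simp_all add: pos_def_defs)
  show "quad_bound 22 70 p (S + r + U)" if "r \<bullet> r \<le> p \<bullet> r" "hangs (6 - 2) p S" "hangs 2 r U" for r S U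
    by (rule quad_bound_split[OF that(1) hangs_4_beside[OF that(2)[simplified]] hangs_2[OF that(3)],
          where l = "140" and ?m1.0 = "7 / 10" and ?m2.0 = "9 / 5"])
      (simp_all add: pos_def_defs)
qed simp_all

lemma hangs_8_below:
  assumes "hangs 8 p T"
  shows "quad_bound (-2) 206 p T"
proof (rule quad_bound_cases[OF assms, where n = 7])
  show "quad_bound (-2) 206 p (r + U)" if "r \<bullet> r \<le> p \<bullet> r" "hangs 7 r U" for r U
    by (rule quad_bound_single[OF that(1) hangs_7_below[OF that(2)], where l = "647" and m = "129 / 100"])
      (simp_all add: pos_def_defs)
  show "quad_bound (-2) 206 p (S + r)" if "r \<bullet> r \<le> p \<bullet> r" "hangs 7 p S" for r S
    by (rule quad_bound_leaf[OF that(1) hangs_7_below[OF that(2)], where l = "110" and m = "7 / 10"])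
      (simp_all add: pos_def_defs)
  show "quad_bound (-2) 206 p (S + r + U)" if "r \<bullet> r \<le> p \<bullet> r" "hangs (7 - 1) p S" "hangs 1 r U" for r S U
    by (rule quad_bound_split[OF that(1) hangs_6_below[OF that(2)[simplified]] hangs_1[OF that(3)],
          where l = "160" and ?m1.0 = "3 / 5" and ?m2.0 = "5"])
      (simp_all add: pos_def_defs)
  show "quad_bound (-2) 206 p (S + r + U)" if "r \<bullet> r \<le> p \<bullet> r" "hangs (7 - 2) p S" "hangs 2 r U" for r S U
    by (rule quad_bound_split[OF that(1) hangs_5_below[OF that(2)[simplified]] hangs_2[OF that(3)],
          where l = "200" and ?m1.0 = "3 / 5" and ?m2.0 = "12 / 5"])
      (simp_all add: pos_def_defs)
  show "quad_bound (-2) 206 p (S + r + U)" if "r \<bullet> r \<le> p \<bullet> r" "hangs (7 - 3) p S" "hangs 3 r U" for r S U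
    by (rule quad_bound_split[OF that(1) hangs_4_below[OF that(2)[simplified]] hangs_3[OF that(3)],
          where l = "240" and ?m1.0 = "3 / 5" and ?m2.0 = "8 / 5"])
      (simp_all add: pos_def_defs)
qed simp_all

lemma hangs_8_beside:
  assumes "hangs 8 p T"
  shows "quad_bound 33 65 p T"
proof (rule quad_bound_cases[OF assms, where n = 7])
  show "quad_bound 33 65 p (r + U)" if "r \<bullet> r \<le> p \<bullet> r" "hangs 7 r U" for r U
    by (rule quad_bound_single[OF that(1) hangs_7_below[OF that(2)], where l = "82" and m = "51 / 100"])
      (simp_all add: pos_def_defs)
  show "quad_bound 33 65 p (S + r)" if "r \<bullet> r \<le> p \<bullet> r" "hangs 7 p S" for r S
    by (rule quad_bound_leaf[OF that(1) hangs_7_beside[OF that(2)], where l = "60" and m = "7 / 10"])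
      (simp_all add: pos_def_defs)
  show "quad_bound 33 65 p (S + r + U)" if "r \<bullet> r \<le> p \<bullet> r" "hangs (7 - 1) p S" "hangs 1 r U" for r S U
    by (rule quad_bound_split[OF that(1) hangs_6_beside[OF that(2)[simplified]] hangs_1[OF that(3)],
          where l = "100" and ?m1.0 = "7 / 10" and ?m2.0 = "11 / 5"])
      (simp_all add: pos_def_defs)
  show "quad_bound 33 65 p (S + r + U)" if "r \<bullet> r \<le> p \<bullet> r" "hangs (7 - 2) p S" "hangs 2 r U" for r S U
    by (rule quad_bound_split[OF that(1) hangs_5_beside[OF that(2)[simplified]] hangs_2[OF that(3)],
          where l = "120" and ?m1.0 = "3 / 5" and ?m2.0 = "13 / 10"])
      (simp_all add: pos_def_defs)
  show "quad_bound 33 65 p (S + r + U)" if "r \<bullet> r \<le> p \<bullet> r" "hangs (7 - 3) p S" "hangs 3 r U" for r S U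
    by (rule quad_bound_split[OF that(1) hangs_4_beside[OF that(2)[simplified]] hangs_3[OF that(3)],
          where l = "90" and ?m1.0 = "2 / 5" and ?m2.0 = "7 / 10"])
      (simp_all add: pos_def_defs)
qed simp_all

text \<open>This is \<open>50 \<parallel>p + T\<parallel>\<^sup>2 \<ge> \<parallel>p\<parallel>\<^sup>2 / 200\<close>, because \<open>50 - 9999 / 200 = 1 / 200\<close>. With
  \<open>C = 50\<close> it would be trivial; everything above serves to push \<open>C\<close> below 50.\<close>
lemma hangs_9:
  assumes "hangs 9 p T"
  shows "quad_bound 50 (9999 / 200) p T"
proof (rule quad_bound_cases[OF assms, where n = 8])
  show "quad_bound 50 (9999 / 200) p (r + U)" if "r \<bullet> r \<le> p \<bullet> r" "hangs 8 r U" for r U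
    by (rule quad_bound_single[OF that(1) hangs_8_below[OF that(2)], where l = "31 / 10" and m = "29 / 1000"])
      (simp_all add: pos_def_defs)
  show "quad_bound 50 (9999 / 200) p (S + r)" if "r \<bullet> r \<le> p \<bullet> r" "hangs 8 p S" for r S
    by (rule quad_bound_leaf[OF that(1) hangs_8_beside[OF that(2)], where l = "8" and m = "1 / 5"])
      (simp_all add: pos_def_defs)
  show "quad_bound 50 (9999 / 200) p (S + r + U)" if "r \<bullet> r \<le> p \<bullet> r" "hangs (8 - 1) p S" "hangs 1 r U" for r S U
    by (rule quad_bound_split[OF that(1) hangs_7_beside[OF that(2)[simplified]] hangs_1[OF that(3)],
          where l = "7" and ?m1.0 = "7 / 100" and ?m2.0 = "11 / 100"])
      (simp_all add: pos_def_defs)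
  show "quad_bound 50 (9999 / 200) p (S + r + U)" if "r \<bullet> r \<le> p \<bullet> r" "hangs (8 - 2) p S" "hangs 2 r U" for r S U
    by (rule quad_bound_split[OF that(1) hangs_6_beside[OF that(2)[simplified]] hangs_2[OF that(3)],
          where l = "41 / 5" and ?m1.0 = "49 / 1000" and ?m2.0 = "37 / 500"])
      (simp_all add: pos_def_defs)
  show "quad_bound 50 (9999 / 200) p (S + r + U)" if "r \<bullet> r \<le> p \<bullet> r" "hangs (8 - 3) p S" "hangs 3 r U" for r S U
    by (rule quad_bound_split[OF that(1) hangs_5_beside[OF that(2)[simplified]] hangs_3[OF that(3)],
          where l = "79 / 25" and ?m1.0 = "141 / 10000" and ?m2.0 = "117 / 5000"])
      (simp_all add: pos_def_defs)
qed simp_all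

section \<open>From parents to forests\<close>
lemma norm_less_of_inner_ge:
  fixes x y :: "'a::real_inner"
  assumes "x \<bullet> x \<le> y \<bullet> x" and "y \<noteq> x"
  shows "norm x < norm y"
proof -
  have "0 < (y - x) \<bullet> (y - x)"
    using assms(2) by simp
  then have "x \<bullet> x < y \<bullet> y"
    using assms(1) by (simp add: inner_simps inner_commute[of x y])
  then show ?thesis
    by (simp add: norm_lt)
qed

text \<open>By \<open>norm_less_of_inner_ge\<close>, parents are longer than their children, so following \<open>f\<close> upwards from any element of \<open>S\<close>
  ends in \<open>v\<close>. The longest \<open>y\<close> in \<open>S\<close> can only have parent \<open>v\<close>. Its descendants \<open>D\<close> form a forest
  below \<open>y\<close>, the rest \<open>E\<close> a forest below \<open>v\<close>, and both are smaller than \<open>S\<close>.\<close>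
lemma hangs_sum:
  fixes S :: "'a::real_inner set"
  assumes "finite S" and "v \<notin> S"
    and "\<And>y. y \<in> S \<Longrightarrow> f y \<in> insert v S" and "\<And>y. y \<in> S \<Longrightarrow> f y \<noteq> y"
    and "\<And>y. y \<in> S \<Longrightarrow> y \<bullet> y \<le> f y \<bullet> y"
  shows "hangs (card S) v (\<Sum>S)"
  using assms
proof (induction "card S" arbitrary: S v rule: less_induct)
  case less
  show ?case
  proof (cases "S = {}")
    case True
    then show ?thesis by (simp add: hangs_none)
  next
    case False
    then obtain y where y: "y \<in> S" "\<And>z. z \<in> S \<Longrightarrow> norm z \<le> norm y"
      using less.prems(1) obtains_MAX[of S norm] by (metis Max_ge finite_imageI imageI)
    have up: "norm z < norm (f z)" if "z \<in> S" for z
      using norm_less_of_inner_ge less.prems(4,5) that by blast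
    have fy: "f y = v"
      using less.prems(3)[OF y(1)] y(2) up[OF y(1)] by force
    define R where "R = {(z, f z) | z. z \<in> S}"
    define D where "D = {z \<in> S. (z, y) \<in> R\<^sup>+}"
    define E where "E = S - D - {y}"
    have "norm a < norm b" if "(a, b) \<in> R\<^sup>+" for a b
      using that by (induction rule: trancl_induct) (auto simp: R_def dest: up)
    then have yD: "y \<notin> D"
      unfolding D_def by blast
    have fD: "f z \<in> insert y D" if "z \<in> D" for z
    proof -
      have "(z, y) \<in> R\<^sup>+"
        using that by (simp add: D_def)
      then show ?thesis
        by (cases rule: converse_tranclE) (auto simp: R_def D_def dest: tranclD)
    qed
    have fE: "f z \<in> insert v E" if "z \<in> E" for z
    proof -
      have z: "(z, f z) \<in> R" "f z \<in> insert v S"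
        using that less.prems(3) by (auto simp: E_def R_def)
      have "f z \<noteq> y" "f z \<notin> D"
        using that z(1) by (auto simp: E_def D_def intro: trancl_into_trancl2)
      then show ?thesis
        using z(2) by (auto simp: E_def)
    qed
    have sub: "D \<subseteq> S" "E \<subseteq> S"
      by (auto simp: D_def E_def)
    have S: "S = insert y (E \<union> D)" "E \<inter> D = {}" "y \<notin> E"
      using y(1) by (auto simp: D_def E_def)
    have fin: "finite D" "finite E"
      using less.prems(1) sub finite_subset by blast+
    have card: "card S = Suc (card E + card D)"
      by (subst S(1)) (use S yD fin in \<open>simp add: card_Un_disjoint\<close>)
    have "hangs (card E) v (\<Sum>E)"
      using less.prems sub fE fin card by (intro less.hyps) auto
    moreover have "hangs (card D) y (\<Sum>D)"
      using less.prems sub fD fin card yD by (intro less.hyps) auto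
    moreover have "y \<bullet> y \<le> v \<bullet> y"
      using less.prems(5)[OF y(1)] fy by simp
    ultimately have "hangs (Suc (card E + card D)) v (\<Sum>E + y + \<Sum>D)"
      by (rule hangs_attach)
    moreover have "\<Sum>S = \<Sum>E + y + \<Sum>D"
      by (subst S(1)) (use S yD fin in \<open>simp add: sum.union_disjoint algebra_simps\<close>)
    ultimately show ?thesis
      using card by simp
  qed
qed

section \<open>Unstable equilibria\<close>

text \<open>The perpendicular hyperplane \<open>h\<close> supports \<open>P\<close>, so \<open>P \<inter> h\<close> is a face. Its extreme points are
  vertices of \<open>P\<close> on \<open>h\<close>, which leaves only \<open>q\<close>, and a compact convex set is the hull of its extreme
  points.\<close>
lemma extreme_point_unstable:
  fixes P :: "'a::euclidean_space set"
  assumes P: "polytope P" and q: "q \<in> vertices P" and "q \<noteq> g"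
    and strict: "\<And>x. x \<in> vertices P \<Longrightarrow> x \<noteq> q \<Longrightarrow> (q - g) \<bullet> x < (q - g) \<bullet> q"
  shows "unstable_equilibrium P g q"
proof -
  define h where "h = {x. (q - g) \<bullet> x = (q - g) \<bullet> q}"
  have h: "perp_hyperplane g q = h"
    by (auto simp: perp_hyperplane_def h_def inner_diff_right)
  have cc: "compact P" "convex P"
    using P by (auto simp: polytope_imp_compact polytope_imp_convex)
  have qP: "q \<in> P"
    using q by (auto simp: vertices_def extreme_point_of_def)
  have hull: "P = convex hull (vertices P)"
    unfolding vertices_def using Krein_Milman_Minkowski[OF cc] by simp
  have le: "P \<subseteq> {x. (q - g) \<bullet> x \<le> (q - g) \<bullet> q}"
    by (subst hull, rule hull_minimal) (use strict in \<open>force simp: convex_halfspace_le\<close>)+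
  have face: "(P \<inter> h) face_of P"
    unfolding h_def using cc(2) le by (intro face_of_Int_supporting_hyperplane_le) auto
  have "{x. x extreme_point_of (P \<inter> h)} = {q}"
    using q qP strict unfolding extreme_point_of_face[OF face] by (force simp: vertices_def h_def)
  then have "P \<inter> h = {q}"
    using Krein_Milman_Minkowski[of "P \<inter> h"] face cc
    by (metis convex_hull_singleton face_of_imp_compact face_of_imp_convex)
  then have hP: "h \<inter> P = {q}"
    by auto
  have qface: "{q} face_of P"
    using q by (simp add: vertices_def face_of_singleton)
  have "F = {q}" if "F face_of P" "q \<in> rel_interior F" for F
    using face_of_eq[OF that(1) qface] that(2) by simp
  moreover have "0 \<le> aff_dim {q}" "aff_dim {q} \<le> int DIM('a) - 1" "q \<in> rel_interior {q}"
    using DIM_positive[where 'a = 'a] by simp_all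
  ultimately have "{F. F face_of P \<and> 0 \<le> aff_dim F \<and> aff_dim F \<le> int DIM('a) - 1 \<and> q \<in> rel_interior F}
      = {{q}}"
    using qface by blast
  moreover have "q \<in> frontier P"
    using qP q cc(1) extreme_point_not_in_interior[of q P]
    by (auto simp: frontier_def vertices_def compact_imp_closed)
  moreover have "supports_at h P q"
    unfolding supports_at_def using le hP \<open>q \<noteq> g\<close> by (auto simp: h_def intro!: exI[of _ "q - g"])
  ultimately show ?thesis
    unfolding unstable_equilibrium_def nondegenerate_equilibrium_def equilibrium_point_def h hP by simp
qed

section \<open>Mono-unstable skeletons have at least eleven vertices\<close>
theorem theorem4:
  fixes P :: "(real ^ 3) set"
  assumes "polytope P" and "aff_dim P = 3" and "card (vertices P) < 11"
  shows "\<not> mono_unstable_skeleton P"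
proof
  assume "mono_unstable_skeleton P"
  define g where "g = skeleton_center P"
  obtain q where q: "{q. unstable_equilibrium P g q} = {q}"
    using \<open>mono_unstable_skeleton P\<close> unfolding mono_unstable_skeleton_def g_def[symmetric]
    by (rule card_1_singletonE)
  define Y where "Y = (\<lambda>x. x - g) ` vertices P"
  have hull: "P = convex hull (vertices P)"
    unfolding vertices_def
    using Krein_Milman_Minkowski assms(1) polytope_imp_compact polytope_imp_convex by blast
  have fin: "finite (vertices P)"
    unfolding vertices_def
    using finite_polyhedron_extreme_points polytope_imp_polyhedron[OF assms(1)] by blast
  have ne: "vertices P \<noteq> {}"
    using hull assms(2) by auto
  have not_single: "vertices P \<noteq> {x}" for x
    using hull assms(2) by (metis aff_dim_sing convex_hull_singleton zero_neq_numeral)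
  have cardY: "card Y = card (vertices P)"
    unfolding Y_def by (intro card_image inj_onI) auto
  have sumY: "\<Sum>Y = 0"
  proof -
    have "\<Sum>Y = (\<Sum>x\<in>vertices P. x - g)"
      unfolding Y_def by (subst sum.reindex) (auto intro: inj_onI)
    also have "\<dots> = (\<Sum>x\<in>vertices P. x) - real (card (vertices P)) *\<^sub>R g"
      by (simp add: sum_subtractf sum_constant_scaleR del: sum_constant)
    also have "\<dots> = 0"
      using fin ne by (simp add: g_def skeleton_center_def)
    finally show ?thesis .
  qed
  (* A vertex without a parent is an unstable equilibrium, and there is only one. *)
  have isolated: "y = q - g"
    if y: "y \<in> Y" "y \<noteq> 0" and no_parent: "\<And>x. x \<in> Y \<Longrightarrow> x \<noteq> y \<Longrightarrow> x \<bullet> y < y \<bullet> y" for y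
  proof -
    obtain x where x: "x \<in> vertices P" "y = x - g"
      using y(1) by (auto simp: Y_def)
    have "unstable_equilibrium P g x"
    proof (rule extreme_point_unstable[OF assms(1) x(1)])
      show "x \<noteq> g"
        using x y by simp
      show "(x - g) \<bullet> z < (x - g) \<bullet> x" if "z \<in> vertices P" "z \<noteq> x" for z
      proof -
        have "(x - g) \<bullet> (z - g) < (x - g) \<bullet> (x - g)"
          using no_parent[of "z - g"] that x by (simp add: Y_def inner_commute[of "x - g" "z - g"])
        then show ?thesis
          by (simp add: inner_diff_right)
      qed
    qed
    then have "x = q"
      using q by blast
    then show ?thesis
      using x(2) by simp
  qed
  obtain v where v: "v \<in> Y" "\<And>y. y \<in> Y \<Longrightarrow> norm y \<le> norm v"
  proof -
    have "finite (norm ` Y)" "norm ` Y \<noteq> {}"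
      using fin ne by (auto simp: Y_def)
    then obtain v where "v \<in> Y" "norm v = Max (norm ` Y)"
      by (metis Max_in imageE)
    then show thesis
      using \<open>finite (norm ` Y)\<close> by (intro that) auto
  qed
  have "v \<noteq> 0"
  proof
    assume "v = 0"
    then have "Y \<subseteq> {0}"
      using v(2) by fastforce
    then have "vertices P \<subseteq> {g}"
      by (auto simp: Y_def)
    then show False
      using ne not_single by blast
  qed
  have v_top: "v = q - g"
  proof (rule isolated[OF v(1) \<open>v \<noteq> 0\<close>])
    show "x \<bullet> v < v \<bullet> v" if "x \<in> Y" "x \<noteq> v" for x
      using norm_less_of_inner_ge[of v x] v(2)[of x] that by force
  qed
  (* A vertex at the center of mass satisfies the parent inequality trivially, as 0 \<le> 0. *)
  have "\<exists>x. x \<in> Y \<and> x \<noteq> y \<and> y \<bullet> y \<le> x \<bullet> y" if "y \<in> Y - {v}" for y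
  proof (cases "y = 0")
    case True
    then show ?thesis
      using v(1) \<open>v \<noteq> 0\<close> by auto
  next
    case False
    then show ?thesis
      using isolated[of y] v_top that by force
  qed
  then obtain f where f: "\<And>y. y \<in> Y - {v} \<Longrightarrow> f y \<in> Y \<and> f y \<noteq> y \<and> y \<bullet> y \<le> f y \<bullet> y"
    by metis
  have "finite Y"
    using fin by (simp add: Y_def)
  then have "hangs (card (Y - {v})) v (\<Sum>(Y - {v}))"
    using f v(1) by (intro hangs_sum[where f = f]) auto
  moreover have "card (Y - {v}) \<le> 9"
    using assms(3) v(1) cardY \<open>finite Y\<close> by simp
  moreover have "\<Sum>(Y - {v}) = - v"
    using sumY v(1) \<open>finite Y\<close> by (simp add: sum_diff1)
  ultimately have "hangs 9 v (- v)"
    using hangs_mono by metis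
  from hangs_9[OF this] have "0 \<le> - (1 / 200) * (v \<bullet> v)"
    by (simp add: quad_bound_def)
  moreover have "0 < v \<bullet> v"
    using \<open>v \<noteq> 0\<close> by simp
  ultimately show False
    by linarith
qed

end
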